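(* Let $u$ be a smooth solution of $\Box_{\mathbb{S}^2_1}u+2u=0$ on a globally hyperbolic strip of $\mathbb{S}^2_1$ containing the Cauchy circle $\Sigma_{t_0}=\{t=t_0\}$. If $u$ and $u_t$ are constant on $\Sigma_{t_0}$, then $u$ is rotationally invariant. More precisely, $u(t,\theta)=f(t)$, where $$f''+\tanh t\,f'-2f=0.$$
   Context: $\mathbb{L}^3=(\mathbb{R}^3,\langle\,,\,\rangle)$ is Lorentz--Minkowski space of signature $(+,+,-)$, and the de Sitter plane is $\mathbb{S}^2_1=\{p\in\mathbb{L}^3:\langle p,p\rangle=1\}$ with the induced Lorentzian metric. Global coordinates $(t,\theta)\in\mathbb{R}\times(\mathbb{R}/2\pi\mathbb{Z})$ are given by $$p(t,\theta)=(\cosh t\cos\theta,\ \cosh t\sin\theta,\ \sinh t),$$ in which the metric is $g=-dt^2+\cosh^2 t\,d\theta^2$. $\Box_{\mathbb{S}^2_1}$ is the metric trace of the Hessian; in these coordinates $$\Box u=-u_{tt}-\tanh t\,u_t+\frac{1}{\cosh^2 t}u_{\theta\theta}.$$ A globally hyperbolic strip containing $\Sigma_{t_0}$ is a region $\{(t,\theta):t_1<t<t_2\}$ with $-\infty\le t_1<t_0<t_2\le\infty$; each circle $\{t=\text{const}\}$ in it is a Cauchy curve. *)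

theory Defs
  imports "HOL-Analysis.Analysis"
begin

text \<open>\<open>C\<^sup>k\<close> and smooth functions on an open set. The Frechet derivatives are taken with the full
  filter \<open>at x\<close>, so these notions are meant for open \<open>S\<close> only.\<close>

fun Ck_on :: "nat \<Rightarrow> 'a::real_normed_vector set \<Rightarrow> ('a \<Rightarrow> 'b::real_normed_vector) \<Rightarrow> bool" where
  "Ck_on 0 S f \<longleftrightarrow> continuous_on S f"
| "Ck_on (Suc k) S f \<longleftrightarrow>
     (\<forall>x\<in>S. f differentiable (at x)) \<and> (\<forall>v. Ck_on k S (\<lambda>x. frechet_derivative f (at x) v))"

definition smooth_on :: "'a::real_normed_vector set \<Rightarrow> ('a \<Rightarrow> 'b::real_normed_vector) \<Rightarrow> bool" where
  "smooth_on S f \<longleftrightarrow> (\<forall>k. Ck_on k S f)"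

definition partial :: "'n::finite \<Rightarrow> (real^'n \<Rightarrow> 'b::real_normed_vector) \<Rightarrow> real^'n \<Rightarrow> 'b" where
  "partial i f x = frechet_derivative f (at x) (axis i 1)"

text \<open>Levi-Civita calculus of a pseudo-Riemannian metric \<open>g\<close> given in coordinates.\<close>

definition christoffel :: "(real^'n \<Rightarrow> real^'n^'n::finite) \<Rightarrow> 'n \<Rightarrow> 'n \<Rightarrow> 'n \<Rightarrow> real^'n \<Rightarrow> real" where
  "christoffel g k i j x = (1/2) * (\<Sum>l\<in>UNIV. matrix_inv (g x) $ k $ l *
     (partial i (\<lambda>y. g y $ j $ l) x + partial j (\<lambda>y. g y $ i $ l) x
        - partial l (\<lambda>y. g y $ i $ j) x))"

text \<open>\<open>christoffel g k i j\<close> is the symbol with upper index \<open>k\<close> and lower indices \<open>i\<close>, \<open>j\<close>.\<close>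

definition hessian ::
  "(real^'n \<Rightarrow> real^'n^'n::finite) \<Rightarrow> (real^'n \<Rightarrow> real) \<Rightarrow> 'n \<Rightarrow> 'n \<Rightarrow> real^'n \<Rightarrow> real" where
  "hessian g f i j x =
     partial i (partial j f) x - (\<Sum>k\<in>UNIV. christoffel g k i j x * partial k f x)"

definition box :: "(real^'n \<Rightarrow> real^'n^'n::finite) \<Rightarrow> (real^'n \<Rightarrow> real) \<Rightarrow> real^'n \<Rightarrow> real" where
  "box g f x = (\<Sum>i\<in>UNIV. \<Sum>j\<in>UNIV. matrix_inv (g x) $ i $ j * hessian g f i j x)"

definition lorentz :: "real^3 \<Rightarrow> real^3 \<Rightarrow> real" where
  "lorentz p q = p $ 1 * q $ 1 + p $ 2 * q $ 2 - p $ 3 * q $ 3"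

definition de_sitter :: "(real^3) set" where
  "de_sitter = {p. lorentz p p = 1}"

text \<open>The coordinates are \<open>x $ 1 = t\<close> and \<open>x $ 2 = \<theta>\<close>. The angle ranges over all of the reals, so
  \<open>dS_param\<close> is the universal covering of the de Sitter plane, and a function \<open>u\<close> on the plane is
  studied through its lift \<open>u \<circ> dS_param\<close>, which is automatically \<open>2\<pi>\<close>-periodic in \<open>\<theta>\<close>.\<close>

definition dS_param :: "real^2 \<Rightarrow> real^3" where
  "dS_param x = vector [cosh (x $ 1) * cos (x $ 2), cosh (x $ 1) * sin (x $ 2), sinh (x $ 1)]"

definition dS_metric :: "real^2 \<Rightarrow> real^2^2" where
  "dS_metric x = (\<chi> i j. lorentz (partial i dS_param x) (partial j dS_param x))"

text \<open>The value at the point \<open>dS_param x\<close>; it depends only on that point, because the lift and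
  \<open>dS_metric\<close> are \<open>2\<pi>\<close>-periodic in \<open>\<theta>\<close>.\<close>

definition dS_box :: "(real^3 \<Rightarrow> real) \<Rightarrow> real^2 \<Rightarrow> real" where
  "dS_box u x = box dS_metric (u \<circ> dS_param) x"

definition strip_coords :: "ereal \<Rightarrow> ereal \<Rightarrow> (real^2) set" where
  "strip_coords t1 t2 = {x. t1 < ereal (x $ 1) \<and> ereal (x $ 1) < t2}"

definition dS_strip :: "ereal \<Rightarrow> ereal \<Rightarrow> (real^3) set" where
  "dS_strip t1 t2 = dS_param ` strip_coords t1 t2"

definition rot :: "real \<Rightarrow> real^3 \<Rightarrow> real^3" where
  "rot a p = vector [cos a * p $ 1 - sin a * p $ 2, sin a * p $ 1 + cos a * p $ 2, p $ 3]"

definition rotationally_invariant_on :: "(real^3) set \<Rightarrow> (real^3 \<Rightarrow> real) \<Rightarrow> bool" where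
  "rotationally_invariant_on S u \<longleftrightarrow> (\<forall>a. \<forall>p\<in>S. u (rot a p) = u p)"

lemma open_strip_coords: "open (strip_coords t1 t2)"
proof -
  have "open {x::real^2. t1 < ereal (x $ 1)}" "open {x::real^2. ereal (x $ 1) < t2}"
    by (intro open_Collect_less continuous_intros)+
  then show ?thesis unfolding strip_coords_def by (simp add: open_Collect_conj)
qed

lemma dS_strip_UNIV: "dS_strip (-\<infinity>) \<infinity> = de_sitter"
proof -
  have "p \<in> range dS_param" if p: "p \<in> de_sitter" for p
  proof -
    define t where "t = arsinh (p $ 3)"
    have s: "sinh t = p $ 3" by (simp add: t_def)
    have c: "cosh t > 0" by simp
    have "(p$1)^2 + (p$2)^2 = (cosh t)^2"
      using p cosh_square_eq[of t] by (simp add: de_sitter_def lorentz_def s power2_eq_square)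
    then have "(p$1 / cosh t)^2 + (p$2 / cosh t)^2 = 1"
      using c by (simp add: power_divide flip: add_divide_distrib)
    then obtain a where a: "p$1 / cosh t = cos a" "p$2 / cosh t = sin a"
      using sincos_total_2pi by metis
    have "p = dS_param (vector [t, a])"
      using a c s by (simp add: dS_param_def vec_eq_iff forall_3 field_simps)
    then show ?thesis by blast
  qed
  moreover have "dS_param x \<in> de_sitter" for x
  proof -
    have "(cosh (x$1) * cos (x$2))^2 + (cosh (x$1) * sin (x$2))^2
            = (cosh (x$1))^2 * ((cos (x$2))^2 + (sin (x$2))^2)"
      by (simp only: power_mult_distrib distrib_left)
    then show ?thesis
      by (simp add: de_sitter_def lorentz_def dS_param_def cosh_square_eq flip: power2_eq_square)
  qed
  ultimately show ?thesis by (auto simp: dS_strip_def strip_coords_def)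
qed

lemma partial_eqI: "(f has_derivative f') (at x) \<Longrightarrow> partial i f x = f' (axis i 1)"
  unfolding partial_def by (metis frechet_derivative_at)

lemma has_derivative_vec_nth [derivative_intros]:
  "(f has_derivative f') F \<Longrightarrow> ((\<lambda>x. f x $ i) has_derivative (\<lambda>h. f' h $ i)) F"
  by (rule bounded_linear.has_derivative[OF bounded_linear_vec_nth])

lemma cosh_sinh_nth_has_derivative:
  "((\<lambda>x. cosh (x $ i)) has_derivative (\<lambda>h. sinh (x $ i) * h $ i)) (at (x::real^'n))"
  "((\<lambda>x. sinh (x $ i)) has_derivative (\<lambda>h. cosh (x $ i) * h $ i)) (at (x::real^'n))"
  by (rule has_derivative_eq_rhs,
      rule DERIV_compose_FDERIV[where f = cosh] DERIV_compose_FDERIV[where f = sinh],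
      (auto intro!: derivative_eq_intros)[3])+

lemma dS_param_has_derivative:
  "(dS_param has_derivative (\<lambda>h. vector
      [sinh (x$1) * h$1 * cos (x$2) - cosh (x$1) * (sin (x$2) * h$2),
       sinh (x$1) * h$1 * sin (x$2) + cosh (x$1) * (cos (x$2) * h$2), cosh (x$1) * h$1])) (at x)"
proof -
  have 1: "vector [a,b,c] = a *\<^sub>R axis 1 1 + b *\<^sub>R axis 2 1 + c *\<^sub>R (axis 3 1 :: real^3)" for a b c
    by (simp add: vec_eq_iff forall_3 axis_def)
  show ?thesis unfolding dS_param_def[abs_def] 1
    by (auto intro!: derivative_eq_intros cosh_sinh_nth_has_derivative ext simp: algebra_simps)
qed

lemma dS_metric_eq:
  "dS_metric x = (\<chi> i j. if i \<noteq> j then 0 else if i = 1 then - 1 else (cosh (x $ 1))^2)"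
proof -
  have e: "(sinh (x$1))^2 = (cosh (x$1))^2 - 1" "(sin (x$2))^2 = 1 - (cos (x$2))^2"
    by (simp_all add: sinh_square_eq sin_squared_eq)
  show ?thesis
    by (simp add: dS_metric_def partial_eqI[OF dS_param_has_derivative] vec_eq_iff forall_2 lorentz_def
        axis_def, intro conjI; insert e; algebra)
qed

text \<open>The coordinate expression of the operator.\<close>

lemma dS_box_eq:
  "dS_box u x = - partial 1 (partial 1 (u \<circ> dS_param)) x
     - tanh (x $ 1) * partial 1 (u \<circ> dS_param) x
     + partial 2 (partial 2 (u \<circ> dS_param)) x / (cosh (x $ 1))^2"
proof -
  have nz: "cosh (x$1) \<noteq> 0" by simp
  have inv: "matrix_inv (dS_metric x) =
      (\<chi> i j. if i \<noteq> j then 0 else if i = 1 then - 1 else 1 / (cosh (x $ 1))^2)" (is "_ = ?B")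
  proof -
    have "dS_metric x ** ?B = mat 1" "?B ** dS_metric x = mat 1"
      using nz by (auto simp: dS_metric_eq matrix_matrix_mult_def mat_def vec_eq_iff forall_2 sum_2)
    then have "dS_metric x ** matrix_inv (dS_metric x) = mat 1 \<and>
        matrix_inv (dS_metric x) ** dS_metric x = mat 1"
      unfolding matrix_inv_def
      using someI[of "\<lambda>A'. dS_metric x ** A' = mat 1 \<and> A' ** dS_metric x = mat 1" ?B] by blast
    moreover have "matrix_inv (dS_metric x) = matrix_inv (dS_metric x) ** (dS_metric x ** ?B)"
      by (simp only: \<open>dS_metric x ** ?B = mat 1\<close> matrix_mul_rid)
    ultimately show ?thesis
      by (simp only: matrix_mul_assoc matrix_mul_lid)
  qed
  have p0: "partial i (\<lambda>y. c) x = 0" for i :: 2 and c :: real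
    by (subst partial_eqI) (auto intro: derivative_intros)
  have pc: "partial i (\<lambda>y. (cosh (y$1))^2) x = 2 * cosh (x$1) * (sinh (x$1) * axis i 1 $ 1)" for i :: 2
    by (subst partial_eqI) (auto intro!: derivative_eq_intros cosh_sinh_nth_has_derivative ext)
  show ?thesis using nz
    by (simp add: dS_box_def box_def hessian_def christoffel_def sum_2 inv)
       (simp add: dS_metric_eq p0 pc axis_def tanh_def, simp add: field_simps power2_eq_square)
qed

end

theory Submission
  imports Defs
begin

text \<open>The proof is the energy method for a linear wave equation on a circle. Write \<open>w\<close> for the lift
  of \<open>u\<close> to the coordinates \<open>(t, \<theta>)\<close>. The equation reads
  \<open>w\<^sub>t\<^sub>t = - tanh t w\<^sub>t + w\<^sub>\<theta>\<^sub>\<theta> / cosh\<^sup>2 t + 2 w\<close>. It is linear and its coefficients do not depend on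
  \<open>\<theta>\<close>, so for each angle \<open>a\<close> the difference \<open>w (t, \<theta> + a) - w (t, \<theta>)\<close> is again a \<open>2\<pi>\<close>-periodic
  solution, and by hypothesis its Cauchy data at \<open>t\<^sub>0\<close> are zero. Rotational invariance is therefore
  uniqueness for zero Cauchy data (\<open>zero_data_imp_zero\<close>).

  For uniqueness, consider the integral \<open>E\<close> of \<open>w\<^sub>t\<^sup>2 + w\<^sub>\<theta>\<^sup>2 / cosh\<^sup>2 t + w\<^sup>2\<close> over one period. In
  \<open>E'\<close> the second-order terms combine to \<open>(2 / cosh\<^sup>2 t) \<partial>\<^sub>\<theta> (w\<^sub>\<theta> w\<^sub>t)\<close>, whose integral over a period
  is zero; what is left is quadratic in the first-order jet and bounded by \<open>5 E\<close> because
  \<open>\<bar>tanh\<bar> \<le> 1\<close>. So \<open>\<bar>E'\<bar> \<le> 5 E\<close> and \<open>E t\<^sub>0 = 0\<close>, and Gronwall's argument, forwards and backwards in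
  time, gives \<open>E = 0\<close>. Once \<open>w\<close> does not depend on \<open>\<theta>\<close>, the term \<open>w\<^sub>\<theta>\<^sub>\<theta>\<close> drops out of the equation,
  and what remains is the ordinary differential equation.\<close>


section \<open>Calculus in one and two real variables\<close>

text \<open>The two factors \<open>exp (\<plusminus> C t)\<close> make \<open>E\<close> monotone in opposite directions, so one of the two
  products bounds \<open>E\<close> by \<open>0\<close> after \<open>t0\<close> and the other before \<open>t0\<close>.\<close>

lemma gronwall_zero:
  fixes E E' :: "real \<Rightarrow> real"
  assumes I: "is_interval I" "t0 \<in> I" "t \<in> I"
    and E: "\<And>t. t \<in> I \<Longrightarrow> (E has_real_derivative E' t) (at t)"
    and bound: "\<And>t. t \<in> I \<Longrightarrow> \<bar>E' t\<bar> \<le> C * E t"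
    and nonneg: "\<And>t. t \<in> I \<Longrightarrow> 0 \<le> E t" and zero: "E t0 = 0"
  shows "E t = 0"
proof -
  have mem: "s \<in> I" if "a \<in> I" "b \<in> I" "a \<le> s" "s \<le> b" for a b s
    using I(1) that unfolding is_interval_1 by blast
  have "E t \<le> 0"
  proof (cases "t0 \<le> t")
    case True
    have "- (E t0 * exp (- C * t0)) \<le> - (E t * exp (- C * t))"
    proof (rule DERIV_nonneg_imp_nondecreasing[OF True])
      fix s assume "t0 \<le> s" "s \<le> t"
      then have s: "s \<in> I" using mem I by blast
      have "((\<lambda>s. - (E s * exp (- C * s))) has_real_derivative
          (C * E s - E' s) * exp (- C * s)) (at s)"
        by (auto intro!: derivative_eq_intros E[OF s] simp: algebra_simps)
      moreover have "0 \<le> (C * E s - E' s) * exp (- C * s)"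
        using bound[OF s] by simp
      ultimately show "\<exists>y. ((\<lambda>s. - (E s * exp (- C * s))) has_real_derivative y) (at s) \<and> 0 \<le> y"
        by blast
    qed
    then show ?thesis by (simp add: zero mult_le_0_iff)
  next
    case False
    then have "t \<le> t0" by simp
    have "E t * exp (C * t) \<le> E t0 * exp (C * t0)"
    proof (rule DERIV_nonneg_imp_nondecreasing[OF \<open>t \<le> t0\<close>])
      fix s assume "t \<le> s" "s \<le> t0"
      then have s: "s \<in> I" using mem I by blast
      have "((\<lambda>s. E s * exp (C * s)) has_real_derivative (C * E s + E' s) * exp (C * s)) (at s)"
        by (auto intro!: derivative_eq_intros E[OF s] simp: algebra_simps)
      moreover have "0 \<le> (C * E s + E' s) * exp (C * s)"
        using bound[OF s] by simp
      ultimately show "\<exists>y. ((\<lambda>s. E s * exp (C * s)) has_real_derivative y) (at s) \<and> 0 \<le> y"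
        by blast
    qed
    then show ?thesis by (simp add: zero mult_le_0_iff)
  qed
  with nonneg[OF I(3)] show ?thesis by simp
qed

text \<open>Symmetry of mixed partial derivatives: the second-order terms of \<open>E'\<close> form a \<open>\<theta>\<close>-derivative
  only if \<open>\<partial>\<^sub>\<theta> w\<^sub>t\<close> and \<open>\<partial>\<^sub>t w\<^sub>\<theta>\<close> agree. Here \<open>w\<close> is written as the time integral of \<open>w\<^sub>t\<close>;
  differentiation in \<open>x\<close> under the integral exhibits \<open>w\<^sub>x\<close> as a time integral of \<open>w\<^sub>t\<^sub>x\<close>.\<close>

lemma mixed_partials_commute:
  fixes w wt wx wtx :: "real \<Rightarrow> real \<Rightarrow> real"
  assumes I: "open I" "is_interval I" and t: "t \<in> I"
    and dt: "\<And>t x. t \<in> I \<Longrightarrow> ((\<lambda>s. w s x) has_real_derivative wt t x) (at t)"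
    and dx: "\<And>t x. t \<in> I \<Longrightarrow> (w t has_real_derivative wx t x) (at x)"
    and dtx: "\<And>t x. t \<in> I \<Longrightarrow> (wt t has_real_derivative wtx t x) (at x)"
    and ct: "continuous_on (I \<times> UNIV) (\<lambda>(t, x). wt t x)"
    and ctx: "continuous_on (I \<times> UNIV) (\<lambda>(t, x). wtx t x)"
  shows "((\<lambda>s. wx s x) has_real_derivative wtx t x) (at t)"
proof -
  obtain d where d: "d > 0" "cball t d \<subseteq> I"
    using I t open_contains_cball by blast
  define a b where "a = t - d" and "b = t + d"
  have ab: "{a..b} \<subseteq> I" using d by (auto simp: a_def b_def cball_eq_atLeastAtMost)
  have t_in: "t \<in> interior {a..b}" using d by (simp add: a_def b_def)
  have slice: "continuous_on {a..b} (\<lambda>s. f s y)"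
    if "continuous_on (I \<times> UNIV) (\<lambda>(t, x). f t x)" for f :: "real \<Rightarrow> real \<Rightarrow> real" and y
    by (rule continuous_on_compose2[OF that, where f = "\<lambda>s. (s, y)", simplified])
       (use ab in \<open>auto intro!: continuous_intros\<close>)
  have swap: "continuous_on (UNIV \<times> cbox a s) (\<lambda>(y, r). wtx r y)" if "s \<le> b" for s
    by (rule continuous_on_eq[OF continuous_on_compose2[OF ctx, where f = "\<lambda>p. (snd p, fst p)"]])
       (use ab that in \<open>auto intro!: continuous_intros simp: subset_iff\<close>)
  have wx_eq: "wx s x = wx a x + integral {a..s} (\<lambda>r. wtx r x)" if s: "s \<in> {a..b}" for s
  proof -
    have sI: "s \<in> I" "a \<in> I" using s ab by auto
    have w_eq: "w s = (\<lambda>y. w a y + integral (cbox a s) (\<lambda>r. wt r y))"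
    proof
      fix y
      have "((\<lambda>r. wt r y) has_integral (w s y - w a y)) {a..s}"
        using s ab
        by (intro fundamental_theorem_of_calculus)
           (auto intro!: has_field_derivative_at_within[OF dt]
             simp flip: has_real_derivative_iff_has_vector_derivative)
      then show "w s y = w a y + integral (cbox a s) (\<lambda>r. wt r y)"
        by (simp add: integral_unique)
    qed
    have "((\<lambda>y. integral (cbox a s) (\<lambda>r. wt r y)) has_real_derivative
        integral (cbox a s) (\<lambda>r. wtx r x)) (at x within UNIV)"
    proof (rule leibniz_rule_field_derivative[where f = "\<lambda>y r. wt r y" and fx = "\<lambda>y r. wtx r y"])
      show "(\<lambda>r. wt r y) integrable_on cbox a s" for y
        using s by (intro integrable_continuous continuous_on_subset[OF slice[OF ct]]) auto
      show "((\<lambda>y. wt r y) has_real_derivative wtx r y) (at y within UNIV)"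
        if "r \<in> cbox a s" for y r
        using that s ab by (intro dtx) auto
      show "continuous_on (UNIV \<times> cbox a s) (\<lambda>(y, r). wtx r y)"
        using s by (intro swap) auto
    qed auto
    from DERIV_add[OF dx[OF sI(2), of x] this]
    have "(w s has_real_derivative wx a x + integral {a..s} (\<lambda>r. wtx r x)) (at x)"
      by (simp only: w_eq flip: box_real)
    with dx[OF sI(1)] show ?thesis by (rule DERIV_unique)
  qed
  have "t \<in> {a..b}" using t_in interior_subset by blast
  then have "((\<lambda>s. wx a x + integral {a..s} (\<lambda>r. wtx r x)) has_real_derivative wtx t x)
      (at t within {a..b})"
    using DERIV_add[OF DERIV_const integral_has_real_derivative[OF slice[OF ctx]]] by fastforce
  then have "((\<lambda>s. wx s x) has_real_derivative wtx t x) (at t within {a..b})"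
    by (rule has_field_derivative_transform_within[where d = 1])
       (use \<open>t \<in> {a..b}\<close> in \<open>auto simp flip: wx_eq\<close>)
  then show ?thesis by (simp add: at_within_interior[OF t_in])
qed

lemma DERIV_periodic:
  fixes f f' :: "real \<Rightarrow> real"
  assumes "\<And>x. (f has_real_derivative f' x) (at x)" and "\<And>x. f (x + c) = f x"
  shows "f' (x + c) = f' x"
proof -
  have "((\<lambda>x. f (x + c)) has_real_derivative f' (x + c)) (at x)"
    using assms(1)[of "x + c"] by (simp only: DERIV_shift)
  then have "(f has_real_derivative f' (x + c)) (at x)"
    by (simp add: assms(2))
  then show ?thesis using assms(1) by (rule DERIV_unique)
qed


section \<open>The wave equation in coordinates\<close>

text \<open>The functions are the second-order jet of one solution \<open>w\<close> on a time interval \<open>I\<close>, with \<open>wtx\<close>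
  standing for \<open>\<partial>\<^sub>x wt\<close>. Giving the jet explicitly makes the class closed under translation in \<open>x\<close>
  and differences by termwise verification.\<close>

locale de_sitter_wave =
  fixes I :: "real set" and w wt wx wtt wtx wxx :: "real \<Rightarrow> real \<Rightarrow> real"
  assumes open_I: "open I" and interval_I: "is_interval I"
    and dt: "\<And>t x. t \<in> I \<Longrightarrow> ((\<lambda>s. w s x) has_real_derivative wt t x) (at t)"
    and dx: "\<And>t x. t \<in> I \<Longrightarrow> (w t has_real_derivative wx t x) (at x)"
    and dtt: "\<And>t x. t \<in> I \<Longrightarrow> ((\<lambda>s. wt s x) has_real_derivative wtt t x) (at t)"
    and dtx: "\<And>t x. t \<in> I \<Longrightarrow> (wt t has_real_derivative wtx t x) (at x)"
    and dxx: "\<And>t x. t \<in> I \<Longrightarrow> (wx t has_real_derivative wxx t x) (at x)"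
    and cont_w: "continuous_on (I \<times> UNIV) (\<lambda>(t, x). w t x)"
    and cont_wt: "continuous_on (I \<times> UNIV) (\<lambda>(t, x). wt t x)"
    and cont_wx: "continuous_on (I \<times> UNIV) (\<lambda>(t, x). wx t x)"
    and cont_wtt: "continuous_on (I \<times> UNIV) (\<lambda>(t, x). wtt t x)"
    and cont_wtx: "continuous_on (I \<times> UNIV) (\<lambda>(t, x). wtx t x)"
    and periodic: "\<And>t x. t \<in> I \<Longrightarrow> w t (x + 2 * pi) = w t x"
    and wave: "\<And>t x. t \<in> I \<Longrightarrow>
      wtt t x = - tanh t * wt t x + wxx t x / (cosh t)\<^sup>2 + 2 * w t x"
begin

lemma dxt: "t \<in> I \<Longrightarrow> ((\<lambda>s. wx s x) has_real_derivative wtx t x) (at t)"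
  by (rule mixed_partials_commute[OF open_I interval_I _ dt dx dtx cont_wt cont_wtx])

lemma wx_periodic: "t \<in> I \<Longrightarrow> wx t (x + 2 * pi) = wx t x"
  by (rule DERIV_periodic[OF dx periodic])

lemma wt_periodic:
  assumes "t \<in> I"
  shows "wt t (x + 2 * pi) = wt t x"
proof -
  have "((\<lambda>s. w s (x + 2 * pi)) has_real_derivative wt t x) (at t)"
    by (rule has_field_derivative_transform_within_open[OF dt[OF assms] open_I assms])
       (simp add: periodic)
  then show ?thesis using dt[OF assms] DERIV_unique by blast
qed

lemma cont_slice:
  assumes "continuous_on (I \<times> UNIV) (\<lambda>(t, x). f t x)" "t \<in> I"
  shows "continuous_on A (\<lambda>x. f t x :: real)"
  by (rule continuous_on_compose2[OF assms(1), where f = "\<lambda>x. (t, x)", simplified])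
     (use assms in \<open>auto intro!: continuous_intros\<close>)

lemmas cont_slices = cont_slice[OF cont_w] cont_slice[OF cont_wt] cont_slice[OF cont_wx]
  cont_slice[OF cont_wtt] cont_slice[OF cont_wtx]

definition energy_density :: "real \<Rightarrow> real \<Rightarrow> real" where
  "energy_density t x = (wt t x)\<^sup>2 + (wx t x)\<^sup>2 / (cosh t)\<^sup>2 + (w t x)\<^sup>2"

text \<open>The time derivative of the density, after the equation has replaced \<open>wtt\<close> and the divergence
  \<open>(2 / cosh\<^sup>2 t) \<partial>\<^sub>x (wx wt)\<close> has been removed.\<close>

definition energy_defect :: "real \<Rightarrow> real \<Rightarrow> real" where
  "energy_defect t x =
     - 2 * tanh t * ((wt t x)\<^sup>2 + (wx t x)\<^sup>2 / (cosh t)\<^sup>2) + 6 * (w t x * wt t x)"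

definition energy :: "real \<Rightarrow> real \<Rightarrow> real" where
  "energy y t = integral {y..y + 2 * pi} (energy_density t)"

lemma energy_density_nonneg: "0 \<le> energy_density t x"
  by (simp add: energy_density_def)

lemma energy_defect_bound: "\<bar>energy_defect t x\<bar> \<le> 5 * energy_density t x"
proof -
  define P where "P = (wt t x)\<^sup>2 + (wx t x)\<^sup>2 / (cosh t)\<^sup>2"
  have P: "(wt t x)\<^sup>2 \<le> P" "0 \<le> P" by (simp_all add: P_def)
  have "\<bar>tanh t * P\<bar> \<le> 1 * P"
    using tanh_real_bounds[of t] P unfolding abs_mult by (intro mult_mono) auto
  moreover have "\<bar>6 * (w t x * wt t x)\<bar> \<le> 3 * (w t x)\<^sup>2 + 3 * (wt t x)\<^sup>2"
    using zero_le_power2[of "w t x - wt t x"] zero_le_power2[of "w t x + wt t x"]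
    by (simp add: power2_eq_square algebra_simps abs_le_iff)
  ultimately have "\<bar>- 2 * (tanh t * P) + 6 * (w t x * wt t x)\<bar> \<le> 5 * (P + (w t x)\<^sup>2)"
    using P zero_le_power2[of "w t x"] unfolding abs_le_iff distrib_left
    by (intro conjI; linarith)
  then show ?thesis
    by (simp add: energy_defect_def energy_density_def P_def mult.assoc)
qed

lemma energy_density_continuous: "t \<in> I \<Longrightarrow> continuous_on A (energy_density t)"
  unfolding energy_density_def[abs_def] by (intro continuous_intros cont_slices) auto

lemma energy_defect_continuous: "t \<in> I \<Longrightarrow> continuous_on A (energy_defect t)"
  unfolding energy_defect_def[abs_def] by (intro continuous_intros cont_slices) auto

lemma energy_has_derivative:
  assumes t: "t \<in> I"
  shows "(energy y has_real_derivative integral {y..y + 2 * pi} (energy_defect t)) (at t)"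
proof -
  let ?J = "{y..y + 2 * pi}"
  define e' where "e' s x = 2 * wt s x * wtt s x + (2 * wx s x * wtx s x) / (cosh s)\<^sup>2
    - 2 * tanh s * (wx s x)\<^sup>2 / (cosh s)\<^sup>2 + 2 * w s x * wt s x" for s x
  have d: "((\<lambda>s. energy_density s x) has_real_derivative e' s x) (at s within I)"
    if "s \<in> I" for s x
    unfolding energy_density_def e'_def
    by (rule has_field_derivative_at_within)
       (auto intro!: derivative_eq_intros dt[OF that] dtt[OF that] dxt[OF that]
         simp: tanh_def field_simps power2_eq_square)
  have conts: "continuous_on (I \<times> cbox y (y + 2 * pi)) (\<lambda>p. f (fst p) (snd p))"
    if "continuous_on (I \<times> UNIV) (\<lambda>(t, x). f t x)" for f :: "real \<Rightarrow> real \<Rightarrow> real"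
    using continuous_on_subset[OF that] by (simp add: split_beta Sigma_mono)
  note cs = conts[OF cont_w] conts[OF cont_wt] conts[OF cont_wx]
    conts[OF cont_wtt] conts[OF cont_wtx]
  have c: "continuous_on (I \<times> cbox y (y + 2 * pi)) (\<lambda>(s, x). e' s x)"
    unfolding e'_def split_beta by (intro continuous_intros cs) auto
  have "((\<lambda>s. integral (cbox y (y + 2 * pi)) (energy_density s)) has_real_derivative
      integral (cbox y (y + 2 * pi)) (e' t)) (at t within I)"
    using interval_I
    by (intro leibniz_rule_field_derivative[OF d _ c t] integrable_continuous
        energy_density_continuous) (auto simp: is_interval_convex_1)
  then have "(energy y has_real_derivative integral ?J (e' t)) (at t)"
    using at_within_open[OF t open_I] by (simp add: energy_def[abs_def])
  \<comment> \<open>\<open>e'\<close> is the defect plus a multiple of \<open>\<partial>\<^sub>x (wx wt)\<close>; the \<open>0\<close> is the integral of the latter.\<close>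
  moreover have "(e' t has_integral integral ?J (energy_defect t) + 2 / (cosh t)\<^sup>2 * 0) ?J"
  proof -
    have "((\<lambda>x. wxx t x * wt t x + wx t x * wtx t x) has_integral
        wx t (y + 2 * pi) * wt t (y + 2 * pi) - wx t y * wt t y) ?J"
      by (rule fundamental_theorem_of_calculus)
         (auto intro!: derivative_eq_intros has_field_derivative_at_within[OF dxx[OF t]]
             has_field_derivative_at_within[OF dtx[OF t]]
           simp flip: has_real_derivative_iff_has_vector_derivative)
    then have div: "((\<lambda>x. wxx t x * wt t x + wx t x * wtx t x) has_integral 0) ?J"
      by (simp add: wx_periodic[OF t] wt_periodic[OF t])
    have "(energy_defect t has_integral integral ?J (energy_defect t)) ?J"
      by (intro integrable_integral integrable_continuous_real energy_defect_continuous t)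
    from has_integral_add[OF this has_integral_mult_right[OF div, of "2 / (cosh t)\<^sup>2"]]
    show ?thesis
      by (rule has_integral_eq[rotated])
         (simp add: e'_def energy_defect_def wave[OF t] field_simps power2_eq_square)
  qed
  ultimately show ?thesis by (simp add: integral_unique)
qed

text \<open>The period over which the energy is taken starts at the point where \<open>w\<close> is evaluated, so that
  vanishing energy gives vanishing there directly.\<close>

lemma zero_data_imp_zero:
  assumes t0: "t0 \<in> I" "\<And>x. w t0 x = 0" "\<And>x. wt t0 x = 0" and t: "t \<in> I"
  shows "w t y = 0"
proof -
  let ?J = "{y..y + 2 * pi}"
  have "w t0 = (\<lambda>x. 0)" using t0(2) by blast
  then have "wx t0 x = 0" for x
    using dx[OF t0(1), of x] DERIV_const DERIV_unique by metis
  then have E0: "energy y t0 = 0"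
    by (simp add: energy_def energy_density_def[abs_def] t0)
  have E: "energy y t = 0"
  proof (rule gronwall_zero[OF interval_I t0(1) t energy_has_derivative _ _ E0])
    fix s assume s: "s \<in> I"
    have int: "energy_density s integrable_on ?J" "energy_defect s integrable_on ?J"
      by (intro integrable_continuous_real energy_density_continuous energy_defect_continuous s)+
    show "0 \<le> energy y s"
      unfolding energy_def by (intro integral_nonneg int energy_density_nonneg)
    have "norm (integral ?J (energy_defect s)) \<le> integral ?J (\<lambda>x. 5 * energy_density s x)"
      using energy_defect_bound
      by (intro integral_norm_bound_integral int integrable_on_mult_right) auto
    then show "\<bar>integral ?J (energy_defect s)\<bar> \<le> 5 * energy y s"
      by (simp add: energy_def)
  qed
  have "energy_density t y = 0"
    using E integral_eq_0_iff[OF energy_density_continuous[OF t], of y "y + 2 * pi"]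
    by (simp add: energy_def energy_density_nonneg)
  then show ?thesis
    unfolding energy_density_def
    by (metis add_nonneg_eq_0_iff add_nonneg_nonneg divide_nonneg_nonneg zero_eq_power2 zero_le_power2)
qed

text \<open>The coefficients of the equation depend on \<open>t\<close> alone, so translates in \<open>x\<close> are solutions, and
  so are differences of solutions by linearity.\<close>

lemma shift_difference_wave:
  "de_sitter_wave I (\<lambda>t x. w t (x + a) - w t x) (\<lambda>t x. wt t (x + a) - wt t x)
     (\<lambda>t x. wx t (x + a) - wx t x) (\<lambda>t x. wtt t (x + a) - wtt t x)
     (\<lambda>t x. wtx t (x + a) - wtx t x) (\<lambda>t x. wxx t (x + a) - wxx t x)"
proof -
  have c: "continuous_on (I \<times> UNIV) (\<lambda>(t, x). f t (x + a) - f t x)"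
    if "continuous_on (I \<times> UNIV) (\<lambda>(t, x). f t x)" for f :: "real \<Rightarrow> real \<Rightarrow> real"
  proof -
    have "continuous_on (I \<times> UNIV) (\<lambda>p. f (fst p) (snd p + a))"
      by (rule continuous_on_compose2[OF that, where f = "\<lambda>p. (fst p, snd p + a)", simplified])
         (auto intro!: continuous_intros)
    with that show ?thesis unfolding split_beta by (rule continuous_on_diff[rotated])
  qed
  have d: "((\<lambda>x. f (x + a) - f x) has_real_derivative f' (x + a) - f' x) (at x)"
    if "\<And>x. (f has_real_derivative f' x) (at x)" for f f' :: "real \<Rightarrow> real" and x
    using that by (intro DERIV_diff) (auto simp flip: DERIV_shift)
  show ?thesis
  proof
    fix t x assume t: "t \<in> I"
    show "w t (x + 2 * pi + a) - w t (x + 2 * pi) = w t (x + a) - w t x"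
      using periodic[OF t, of x] periodic[OF t, of "x + a"] by (simp add: algebra_simps)
    show "wtt t (x + a) - wtt t x = - tanh t * (wt t (x + a) - wt t x)
        + (wxx t (x + a) - wxx t x) / (cosh t)\<^sup>2 + 2 * (w t (x + a) - w t x)"
      by (simp add: wave[OF t] algebra_simps diff_divide_distrib)
  qed (intro open_I interval_I c cont_w cont_wt cont_wx cont_wtt cont_wtx
      DERIV_diff dt dtt d dx dtx dxx; assumption)+
qed

lemma constant_data_imp_rotation_invariant:
  assumes "t0 \<in> I" "\<And>x. w t0 x = w t0 0" "\<And>x. wt t0 x = wt t0 0" "t \<in> I"
  shows "w t x = w t 0"
proof -
  interpret D: de_sitter_wave I "\<lambda>t y. w t (y + x) - w t y" "\<lambda>t y. wt t (y + x) - wt t y"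
     "\<lambda>t y. wx t (y + x) - wx t y" "\<lambda>t y. wtt t (y + x) - wtt t y"
     "\<lambda>t y. wtx t (y + x) - wtx t y" "\<lambda>t y. wxx t (y + x) - wxx t y"
    by (rule shift_difference_wave)
  have "w t0 (y + x) - w t0 y = 0" "wt t0 (y + x) - wt t0 y = 0" for y
    using assms(2,3)[of "y + x"] assms(2,3)[of y] by simp_all
  then have "w t (0 + x) - w t 0 = 0"
    using assms(1,4) by (intro D.zero_data_imp_zero[of t0 t 0])
  then show ?thesis by simp
qed

lemma rotation_invariant_imp_ode:
  assumes t: "t \<in> I" and inv: "\<And>x. w t x = w t 0"
  shows "wtt t 0 + tanh t * wt t 0 - 2 * w t 0 = 0"
proof -
  have "w t = (\<lambda>x. w t 0)" using inv by blast
  then have "wx t x = 0" for x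
    using dx[OF t, of x] DERIV_const DERIV_unique by metis
  then have "wx t = (\<lambda>x. 0)" by blast
  then have "wxx t 0 = 0"
    using dxx[OF t, of 0] DERIV_const DERIV_unique by metis
  then show ?thesis using wave[OF t, of 0] by simp
qed

end


section \<open>The lift of a solution to the coordinates\<close>

abbreviation coord_pt :: "real \<Rightarrow> real \<Rightarrow> real^2" where
  "coord_pt t x \<equiv> vector [t, x]"

lemma coord_pt_eq: "coord_pt t x = t *\<^sub>R axis 1 1 + x *\<^sub>R axis 2 1"
  by (simp add: vec_eq_iff forall_2 axis_def)

lemma coord_pt_nth: "coord_pt (x $ 1) (x $ 2) = x"
  by (simp add: vec_eq_iff forall_2)

lemma DERIV_along_coords:
  fixes f :: "real^2 \<Rightarrow> real"
  assumes "f differentiable (at (coord_pt t x))"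
  shows "((\<lambda>s. f (coord_pt s x)) has_real_derivative partial 1 f (coord_pt t x)) (at t)"
    and "((\<lambda>y. f (coord_pt t y)) has_real_derivative partial 2 f (coord_pt t x)) (at x)"
proof -
  let ?D = "frechet_derivative f (at (coord_pt t x))"
  have D: "(f has_derivative ?D) (at (coord_pt t x))"
    using assms frechet_derivative_works by blast
  then have lin: "?D (h *\<^sub>R v) = ?D v * h" for h v
    using has_derivative_bounded_linear linear_simps(5) by (metis mult.commute real_scaleR_def)
  have "((\<lambda>s. f (coord_pt s x)) has_derivative (\<lambda>h. ?D (h *\<^sub>R axis 1 1))) (at t)"
    by (rule has_derivative_compose[where f = "\<lambda>s. coord_pt s x", OF _ D])
       (auto simp: coord_pt_eq intro!: derivative_eq_intros)
  then show "((\<lambda>s. f (coord_pt s x)) has_real_derivative partial 1 f (coord_pt t x)) (at t)"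
    by (simp add: lin partial_def has_field_derivative_def)
  have "((\<lambda>y. f (coord_pt t y)) has_derivative (\<lambda>h. ?D (h *\<^sub>R axis 2 1))) (at x)"
    by (rule has_derivative_compose[where f = "\<lambda>y. coord_pt t y", OF _ D])
       (auto simp: coord_pt_eq intro!: derivative_eq_intros)
  then show "((\<lambda>y. f (coord_pt t y)) has_real_derivative partial 2 f (coord_pt t x)) (at x)"
    by (simp add: lin partial_def has_field_derivative_def)
qed

lemma Ck_on_2_partials:
  fixes f :: "real^'n::finite \<Rightarrow> real"
  assumes "Ck_on 2 S f"
  shows "x \<in> S \<Longrightarrow> f differentiable (at x)"
    and "x \<in> S \<Longrightarrow> partial i f differentiable (at x)"
    and "continuous_on S (partial j (partial i f))"
  using assms by (auto simp: numeral_2_eq_2 partial_def[abs_def])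

text \<open>The angle in the strip ranges over all reals, so periodicity of the lift is the only trace of
  the circle; it is what makes the boundary terms of the energy cancel.\<close>

lemma lift_is_de_sitter_wave:
  fixes u :: "real^3 \<Rightarrow> real"
  defines "v \<equiv> u \<circ> dS_param"
  assumes smooth: "Ck_on 2 (strip_coords t1 t2) v"
    and box: "\<And>x. x \<in> strip_coords t1 t2 \<Longrightarrow> dS_box u x + 2 * u (dS_param x) = 0"
  shows "de_sitter_wave {t. t1 < ereal t \<and> ereal t < t2}
     (\<lambda>t x. v (coord_pt t x)) (\<lambda>t x. partial 1 v (coord_pt t x)) (\<lambda>t x. partial 2 v (coord_pt t x))
     (\<lambda>t x. partial 1 (partial 1 v) (coord_pt t x)) (\<lambda>t x. partial 2 (partial 1 v) (coord_pt t x))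
     (\<lambda>t x. partial 2 (partial 2 v) (coord_pt t x))"
proof -
  let ?I = "{t. t1 < ereal t \<and> ereal t < t2}"
  have S: "coord_pt t x \<in> strip_coords t1 t2" if "t \<in> ?I" for t x
    using that by (simp add: strip_coords_def)
  note C2 = Ck_on_2_partials[OF smooth]
  have cv: "continuous_on (strip_coords t1 t2) v"
    "continuous_on (strip_coords t1 t2) (partial i v)" for i
    using C2(1,2) by (auto intro!: continuous_at_imp_continuous_on differentiable_imp_continuous_within)
  have c: "continuous_on (?I \<times> UNIV) (\<lambda>(t, x). f (coord_pt t x))"
    if "continuous_on (strip_coords t1 t2) f" for f :: "real^2 \<Rightarrow> real"
    unfolding split_beta
    by (rule continuous_on_compose2[OF that])
       (auto simp: S[simplified] coord_pt_eq[abs_def] strip_coords_def axis_def intro!: continuous_intros)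
  show ?thesis
  proof
    have "open ({t. t1 < ereal t} \<inter> {t. ereal t < t2})"
      by (intro open_Int open_Collect_less continuous_intros)
    then show "open ?I" by (simp add: Int_def)
    show "is_interval ?I"
      unfolding is_interval_1
      by (auto intro: less_le_trans le_less_trans simp flip: ereal_less_eq(3))
    fix t x assume t: "t \<in> ?I"
    have "dS_param (coord_pt t (x + 2 * pi)) = dS_param (coord_pt t x)"
      by (simp add: dS_param_def)
    then show "v (coord_pt t (x + 2 * pi)) = v (coord_pt t x)"
      by (simp add: v_def)
    show "partial 1 (partial 1 v) (coord_pt t x) = - tanh t * partial 1 v (coord_pt t x)
        + partial 2 (partial 2 v) (coord_pt t x) / (cosh t)\<^sup>2 + 2 * v (coord_pt t x)"
      using box[OF S[OF t], of x] unfolding dS_box_eq by (simp add: v_def)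
  qed (intro c cv C2(3) DERIV_along_coords C2(1,2) S; assumption)+
qed

lemma rot_dS_param: "rot a (dS_param x) = dS_param (coord_pt (x $ 1) (x $ 2 + a))"
  by (simp add: rot_def dS_param_def cos_add sin_add vec_eq_iff forall_3 algebra_simps)

theorem theoremD:
  fixes u :: "real^3 \<Rightarrow> real" and t0 :: real and t1 t2 :: ereal
  assumes "t1 < ereal t0" and "ereal t0 < t2"
    and "smooth_on (strip_coords t1 t2) (u \<circ> dS_param)"
    and "\<And>x. x \<in> strip_coords t1 t2 \<Longrightarrow> dS_box u x + 2 * u (dS_param x) = 0"
    and "(u \<circ> dS_param) constant_on {x. x $ 1 = t0}"
    and "partial 1 (u \<circ> dS_param) constant_on {x. x $ 1 = t0}"
  shows "rotationally_invariant_on (dS_strip t1 t2) u \<and>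
    (\<exists>f f' f'' :: real \<Rightarrow> real.
       (\<forall>x\<in>strip_coords t1 t2. u (dS_param x) = f (x $ 1)) \<and>
       (\<forall>t. t1 < ereal t \<and> ereal t < t2 \<longrightarrow>
          (f has_real_derivative f' t) (at t) \<and> (f' has_real_derivative f'' t) (at t) \<and>
          f'' t + tanh t * f' t - 2 * f t = 0))"
proof -
  let ?I = "{t. t1 < ereal t \<and> ereal t < t2}"
  let ?v = "u \<circ> dS_param"
  interpret de_sitter_wave ?I
     "\<lambda>t x. ?v (coord_pt t x)" "\<lambda>t x. partial 1 ?v (coord_pt t x)"
     "\<lambda>t x. partial 2 ?v (coord_pt t x)" "\<lambda>t x. partial 1 (partial 1 ?v) (coord_pt t x)"
     "\<lambda>t x. partial 2 (partial 1 ?v) (coord_pt t x)" "\<lambda>t x. partial 2 (partial 2 ?v) (coord_pt t x)"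
    using assms(3,4) by (intro lift_is_de_sitter_wave) (auto simp: smooth_on_def)
  have inv: "?v (coord_pt t x) = ?v (coord_pt t 0)" if "t \<in> ?I" for t x
  proof (rule constant_data_imp_rotation_invariant[OF _ _ _ that])
    show "t0 \<in> ?I" using assms(1,2) by simp
    show "?v (coord_pt t0 y) = ?v (coord_pt t0 0)" for y
      using assms(5) unfolding constant_on_def by force
    show "partial 1 ?v (coord_pt t0 y) = partial 1 ?v (coord_pt t0 0)" for y
      using assms(6) unfolding constant_on_def by force
  qed
  have lift: "u (dS_param x) = ?v (coord_pt (x $ 1) 0)" if "x \<in> strip_coords t1 t2" for x
    using inv[of "x $ 1" "x $ 2"] that by (simp add: coord_pt_nth strip_coords_def)
  have "rotationally_invariant_on (dS_strip t1 t2) u"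
    unfolding rotationally_invariant_on_def dS_strip_def
  proof (intro allI ballI, elim imageE)
    fix a p x assume x: "p = dS_param x" "x \<in> strip_coords t1 t2"
    then show "u (rot a p) = u p"
      using lift[of "coord_pt (x $ 1) (x $ 2 + a)"] lift[of x]
      by (simp add: rot_dS_param strip_coords_def)
  qed
  moreover have "((\<lambda>s. ?v (coord_pt s 0)) has_real_derivative partial 1 ?v (coord_pt t 0)) (at t) \<and>
      ((\<lambda>s. partial 1 ?v (coord_pt s 0)) has_real_derivative
        partial 1 (partial 1 ?v) (coord_pt t 0)) (at t) \<and>
      partial 1 (partial 1 ?v) (coord_pt t 0) + tanh t * partial 1 ?v (coord_pt t 0)
        - 2 * ?v (coord_pt t 0) = 0" if "t1 < ereal t \<and> ereal t < t2" for t
    using that dt dtt rotation_invariant_imp_ode inv by blast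
  ultimately show ?thesis
    using lift
    by (intro conjI exI[of _ "\<lambda>s. ?v (coord_pt s 0)"] exI[of _ "\<lambda>s. partial 1 ?v (coord_pt s 0)"]
        exI[of _ "\<lambda>s. partial 1 (partial 1 ?v) (coord_pt s 0)"]) auto
qed

end
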